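(* Let $\{\xi_k\}_{k=0}^\infty$ be a sequence of independent identically distributed real- or complex-valued random variables with $\mathbf{P}(\xi_0=0)<1$, and let $G_n(z)=\xi_0+\xi_1z+\dots+\xi_nz^n$. Then the sequence of empirical distributions $R_n/n$ of the absolute values of the zeros of $G_n$ converges almost surely to the delta measure at the point one, i.e. for every $\delta>0$ $$\mathbf{P}\left\{\frac1n R_n(1-\delta,1+\delta)\underset{n\to\infty}{\longrightarrow}1\right\}=1,$$ if and only if $$\mathbf{E}\log(1+|\xi_0|)<\infty.$$
   Context: For real $a<b$ (where $b=\infty$ is allowed), $R_n(a,b)$ denotes the number of zeros $z\in\mathbb{C}$ of $G_n$, counted with multiplicity, with $a\leqslant|z|\leqslant b$. On the event that $G_n$ is identically zero (which a.s. occurs for only finitely many $n$) put $R_n=0$. *)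

theory Defs
  imports "HOL-Probability.Probability" "HOL-Computational_Algebra.Polynomial"
begin

definition random_poly :: "(nat \<Rightarrow> 'w \<Rightarrow> complex) \<Rightarrow> nat \<Rightarrow> 'w \<Rightarrow> complex poly" where
  "random_poly \<xi> n \<omega> = (\<Sum>k\<le>n. monom (\<xi> k \<omega>) k)"

(* The upper bound is extended real so that unbounded annuli are allowed. *)
definition annulus_zero_count :: "complex poly \<Rightarrow> real \<Rightarrow> ereal \<Rightarrow> nat" where
  "annulus_zero_count p a b =
     (if p = 0 then 0
      else \<Sum>z | poly p z = 0 \<and> a \<le> cmod z \<and> ereal (cmod z) \<le> b. order z p)"

end

theory Submission
  imports Defs "HOL-Complex_Analysis.Conformal_Mappings"
    "HOL-Computational_Algebra.Fundamental_Theorem_Algebra" "HOL-Real_Asymp.Real_Asymp"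
begin

text \<open>
  If \<open>p\<close> is bounded by \<open>A\<close> on the unit circle and has \<open>N\<close> roots of modulus at most \<open>s < 1\<close>, then
  dividing out Blaschke factors gives \<open>\<bar>p\<bar> \<le> A * \<kappa> ^ N\<close> on \<open>\<bar>z\<bar> = s\<close> for some \<open>\<kappa> < 1\<close>, so by Cauchy's
  estimate a coefficient \<open>a\<^sub>j\<close> that is not small forces \<open>N = O(j + ln A)\<close>.
  If the logarithmic moment is finite, Borel--Cantelli gives \<open>\<bar>\<xi>\<^sub>k\<bar> \<le> exp (\<epsilon> n)\<close> for all \<open>k \<le> n\<close> and an index
  \<open>m \<ge> (1 - \<epsilon>) n\<close> with \<open>\<bar>\<xi>\<^sub>m\<bar> \<ge> c\<close>; applied to \<open>G\<^sub>n\<close> and to the reversed polynomial, the bound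
  leaves only \<open>o(n)\<close> zeros away from the unit circle.
  If the moment is infinite, the second Borel--Cantelli lemma makes \<open>\<bar>\<xi>\<^sub>n\<bar>\<^sup>1\<^sup>/\<^sup>n\<close> unbounded. At each large
  record of this sequence the leading term of \<open>G\<^sub>n\<close> dominates on \<open>\<bar>z\<bar> \<ge> 1/2\<close>, hence all zeros lie in
  \<open>\<bar>z\<bar> < 1/2\<close>.
\<close>

subsection \<open>Counting roots of a polynomial in a disc\<close>

lemma cmod_poly_le_unit_circle:
  fixes p :: "complex poly"
  assumes "\<And>z. cmod z = 1 \<Longrightarrow> cmod (poly p z) \<le> C" and "cmod z \<le> 1"
  shows "cmod (poly p z) \<le> C"
proof (rule maximum_modulus_frontier[where f = "poly p" and S = "cball 0 1"])
  show "poly p holomorphic_on interior (cball 0 1)"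
    by (intro holomorphic_intros)
  show "continuous_on (closure (cball 0 1)) (poly p)"
    by (intro continuous_intros)
qed (use assms in auto)

text \<open>Rests on |1 - cnj a z|^2 - |z - a|^2 = (1 - |a|^2)(1 - |z|^2). The constant is the
  extremal value, attained at \<open>a = -s\<close>, \<open>z = s\<close>; being below 1, it is the
  gain contributed by each root.\<close>

lemma blaschke_factor_le:
  fixes a z :: complex
  assumes "cmod a \<le> s" "cmod z \<le> s" "0 \<le> s" "s < 1"
  shows "cmod (z - a) \<le> 2 * s / (1 + s\<^sup>2) * cmod (1 - cnj a * z)"
proof (rule power2_le_imp_le)
  let ?k = "2 * s / (1 + s\<^sup>2)" and ?D = "(cmod (1 - cnj a * z))\<^sup>2"
  have id: "?D - (cmod (z - a))\<^sup>2 = (1 - (cmod a)\<^sup>2) * (1 - (cmod z)\<^sup>2)"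
    unfolding cmod_power2 by (simp add: algebra_simps power2_eq_square)
  have s2: "s\<^sup>2 < 1" using assms by (simp add: power_less_one_iff abs_square_less_1)
  have "cmod (1 - cnj a * z) \<le> 1 + cmod a * cmod z"
    by (metis complex_mod_cnj norm_mult norm_one norm_triangle_ineq4)
  also have "\<dots> \<le> 1 + s\<^sup>2"
    unfolding power2_eq_square using assms by (intro add_left_mono mult_mono) auto
  finally have "?D \<le> (1 + s\<^sup>2)\<^sup>2"
    by (intro power_mono) auto
  then have "((1 - s\<^sup>2) / (1 + s\<^sup>2))\<^sup>2 * ?D \<le> ((1 - s\<^sup>2) / (1 + s\<^sup>2))\<^sup>2 * (1 + s\<^sup>2)\<^sup>2"
    by (intro mult_left_mono) auto
  also have "\<dots> = (1 - s\<^sup>2)\<^sup>2"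
    by (simp add: power_divide add_nonneg_eq_0_iff)
  also have "\<dots> \<le> (1 - (cmod a)\<^sup>2) * (1 - (cmod z)\<^sup>2)"
    unfolding power2_eq_square[of "1 - s\<^sup>2"] using assms s2
    by (intro mult_mono) (auto intro!: power_mono simp: abs_square_le_1)
  finally have *: "((1 - s\<^sup>2) / (1 + s\<^sup>2))\<^sup>2 * ?D \<le> ?D - (cmod (z - a))\<^sup>2"
    using id by simp
  have pos: "1 + s\<^sup>2 \<noteq> 0" by (metis add_nonneg_eq_0_iff zero_le_one zero_le_power2 zero_neq_one)
  have k: "?k\<^sup>2 = 1 - ((1 - s\<^sup>2) / (1 + s\<^sup>2))\<^sup>2"
    using pos by (simp add: power_divide divide_simps) (simp add: power2_eq_square algebra_simps)
  have "(?k * cmod (1 - cnj a * z))\<^sup>2 = ?D - ((1 - s\<^sup>2) / (1 + s\<^sup>2))\<^sup>2 * ?D"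
    by (simp only: power_mult_distrib k left_diff_distrib mult_1_left)
  with * show "(cmod (z - a))\<^sup>2 \<le> (?k * cmod (1 - cnj a * z))\<^sup>2"
    by simp
qed (use assms in auto)

text \<open>
  Induction over the roots: swapping the factor \<open>z - a\<close> for \<open>1 - cnj a * z\<close> does not change the
  modulus on the unit circle.
\<close>

lemma cmod_poly_le_few_roots:
  fixes p :: "complex poly"
  assumes "p \<noteq> 0" "\<And>z. cmod z = 1 \<Longrightarrow> cmod (poly p z) \<le> C"
    and "0 \<le> s" "s < 1" "cmod z \<le> s"
  shows "cmod (poly p z) \<le>
    C * (2 * s / (1 + s\<^sup>2)) ^ size {#x \<in># proots p. cmod x \<le> s#}"
  using assms(1,2)
proof (induction "size {#x \<in># proots p. cmod x \<le> s#}" arbitrary: p)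
  case 0
  then show ?case
    using cmod_poly_le_unit_circle[of p C z] assms
    by (simp only: 0(1)[symmetric] power_0 mult_1_right)
next
  case (Suc N)
  let ?k = "2 * s / (1 + s\<^sup>2)"
  obtain a where "a \<in># {#x \<in># proots p. cmod x \<le> s#}"
    using size_eq_Suc_imp_elem[OF Suc.hyps(2)[symmetric]] by blast
  then have a: "poly p a = 0" "cmod a \<le> s"
    using Suc.prems(1) by auto
  then obtain q where q: "p = [:-a, 1:] * q"
    by (auto simp: poly_eq_0_iff_dvd)
  then have q0: "q \<noteq> 0" using Suc.prems(1) by auto
  define r where "r = [:1, - cnj a:] * q"
  have poly_p: "poly p w = (w - a) * poly q w" and poly_r: "poly r w = (1 - cnj a * w) * poly q w" for w
    by (simp_all add: q r_def algebra_simps)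
  have r0: "r \<noteq> 0" using q0 unfolding r_def mult_eq_0_iff by simp
  \<comment> \<open>A root of \<open>1 - cnj a * z\<close>, if there is one, lies outside the unit
    disc, so passing from \<open>p\<close> to \<open>r\<close> lowers the count by exactly
    one.\<close>
  have no: "cmod x > s" if "x \<in># proots [:1, - cnj a:]" for x
  proof (rule ccontr)
    assume "\<not> cmod x > s"
    moreover have "cnj a * x = 1" using that by (auto simp: algebra_simps)
    then have "cmod a * cmod x = 1"
      by (metis complex_mod_cnj norm_mult norm_one)
    ultimately have "1 \<le> s * s"
      using a assms(3) by (metis linorder_not_less mult_mono norm_ge_zero)
    then show False
      using assms(3,4) by (metis linorder_not_le mult_left_le order_less_imp_le order_le_less_trans)
  qed
  have "{#x \<in># proots [:1, - cnj a:]. cmod x \<le> s#} = {#}"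
    using no by (auto simp: not_le)
  then have "{#x \<in># proots r. cmod x \<le> s#} = {#x \<in># proots q. cmod x \<le> s#}"
    unfolding r_def using q0 by (subst proots_mult) auto
  moreover have "{#x \<in># proots p. cmod x \<le> s#} = add_mset a {#x \<in># proots q. cmod x \<le> s#}"
    unfolding q using q0 a by (subst proots_mult) auto
  ultimately have N: "N = size {#x \<in># proots r. cmod x \<le> s#}"
    using Suc.hyps(2) by simp
  have "cmod (poly r w) \<le> C" if w: "cmod w = 1" for w
  proof -
    have "cmod (1 - cnj a * w) = cmod (w - a)"
    proof -
      have "w * cnj w = 1" using w complex_norm_square[of w] by simp
      then have "1 - cnj a * w = cnj (w - a) * w" by (simp add: algebra_simps)
      then show ?thesis using w by (simp only: norm_mult complex_mod_cnj mult_1_right)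
    qed
    then have "cmod (poly r w) = cmod (poly p w)"
      by (simp only: poly_p poly_r norm_mult)
    then show ?thesis using Suc.prems(2) w by simp
  qed
  then have IH: "cmod (poly r z) \<le> C * ?k ^ N"
    using Suc.hyps(1)[OF N r0] N by simp
  have "cmod (poly p z) = cmod (z - a) * cmod (poly q z)"
    by (simp only: poly_p norm_mult)
  also have "\<dots> \<le> ?k * cmod (1 - cnj a * z) * cmod (poly q z)"
    using blaschke_factor_le[of a s z] a assms by (intro mult_right_mono) auto
  also have "\<dots> = ?k * cmod (poly r z)"
    by (simp only: poly_r norm_mult mult.assoc)
  also have "\<dots> \<le> ?k * (C * ?k ^ N)"
    using IH assms by (intro mult_left_mono) auto
  finally show ?case
    using Suc.hyps(2) by (metis mult.left_commute power_Suc)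
qed

section \<open>Cauchy's estimate and the number of small roots\<close>

lemma deriv_poly_funpow: "(deriv ^^ n) (poly p) = poly ((pderiv ^^ n) p)" for p :: "complex poly"
  by (induction n) (auto intro!: DERIV_imp_deriv poly_DERIV)

lemma cmod_coeff_le:
  fixes p :: "complex poly"
  assumes "0 < s" "\<And>z. cmod z = s \<Longrightarrow> cmod (poly p z) \<le> B"
  shows "cmod (coeff p j) * s ^ j \<le> B"
proof -
  have "cmod ((deriv ^^ j) (poly p) 0) \<le> fact j * B / s ^ j"
  proof (rule Cauchy_inequality)
    show "poly p holomorphic_on ball 0 s" by (intro holomorphic_intros)
    show "continuous_on (cball 0 s) (poly p)" by (intro continuous_intros)
  qed (use assms in auto)
  moreover have "(deriv ^^ j) (poly p) 0 = fact j * coeff p j"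
    by (simp add: deriv_poly_funpow poly_0_coeff_0 coeff_higher_pderiv pochhammer_fact)
  ultimately show ?thesis
    using assms(1) by (simp add: norm_mult field_simps)
qed

text \<open>On the unit circle the at most \<open>n + 1\<close> coefficients give the bound
  \<open>(n + 1) * A\<close>; the Blaschke gain improves it on the circle of radius
  \<open>s\<close>, where Cauchy's estimate is applied.\<close>

lemma coeff_le_few_roots:
  fixes p :: "complex poly"
  assumes "p \<noteq> 0" "degree p \<le> n" "\<And>k. cmod (coeff p k) \<le> A" "0 < s" "s < 1"
  shows "cmod (coeff p j) * s ^ j \<le>
    real (n + 1) * A * (2 * s / (1 + s\<^sup>2)) ^ size {#x \<in># proots p. cmod x \<le> s#}"
proof (rule cmod_coeff_le)
  have A: "0 \<le> A" using assms(3) norm_ge_zero order_trans by blast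
  have circle: "cmod (poly p z) \<le> real (n + 1) * A" if "cmod z = 1" for z
  proof -
    have "cmod (poly p z) \<le> (\<Sum>k\<le>degree p. cmod (coeff p k * z ^ k))"
      unfolding poly_altdef by (rule norm_sum)
    also have "\<dots> \<le> (\<Sum>k\<le>degree p. A)"
      using assms(3) that by (intro sum_mono) (simp add: norm_mult norm_power)
    also have "\<dots> = real (degree p + 1) * A" by simp
    also have "\<dots> \<le> real (n + 1) * A"
      using assms(2) A by (intro mult_right_mono) auto
    finally show ?thesis .
  qed
  show "cmod (poly p z) \<le> real (n + 1) * A * (2 * s / (1 + s\<^sup>2)) ^ size {#x \<in># proots p. cmod x \<le> s#}"
    if "cmod z = s" for z
    using cmod_poly_le_few_roots[OF assms(1) circle, of s z] that assms by simp
qed fact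

text \<open>Logarithmic form of the previous estimate. The factor multiplying the number of roots is
  positive because 2s < 1 + s^2, so a coefficient of size at least \<open>c\<close> at a low index
  leaves room for few small roots.\<close>

lemma size_small_roots_le:
  fixes p :: "complex poly"
  assumes "degree p \<le> n" "\<And>k. cmod (coeff p k) \<le> A" "0 < s" "s < 1"
    and "c \<le> cmod (coeff p j)" "0 < c"
  shows "real (size {#x \<in># proots p. cmod x \<le> s#}) * ln ((1 + s\<^sup>2) / (2 * s))
    \<le> real j * ln (1 / s) + ln (real (n + 1)) + ln A - ln c"
proof -
  let ?N = "size {#x \<in># proots p. cmod x \<le> s#}" and ?k = "2 * s / (1 + s\<^sup>2)"
  have p0: "p \<noteq> 0" using assms(5,6) by auto
  have A: "0 < A" using assms(2)[of j] assms(5,6) by linarith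
  have s2: "0 < 1 + s\<^sup>2" by (simp add: add_pos_nonneg)
  have "c * s ^ j \<le> cmod (coeff p j) * s ^ j"
    using assms by (intro mult_right_mono) auto
  also have "\<dots> \<le> real (n + 1) * A * ?k ^ ?N"
    using coeff_le_few_roots[OF p0 assms(1-4)] .
  finally have "ln (c * s ^ j) \<le> ln (real (n + 1) * A * ?k ^ ?N)"
    using assms A s2 by (subst ln_le_cancel_iff) auto
  moreover have "ln (c * s ^ j) = ln c + real j * ln s"
    using assms by (simp add: ln_mult ln_realpow)
  moreover have "ln (real (n + 1) * A * ?k ^ ?N) = ln (real (n + 1)) + ln A + real ?N * ln ?k"
    using assms A s2 by (simp add: ln_mult ln_realpow)
  moreover have "ln ((1 + s\<^sup>2) / (2 * s)) = - ln ?k"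
    using assms s2 by (simp add: ln_div)
  moreover have "ln (1 / s) = - ln s"
    using assms by (simp add: ln_div)
  ultimately show ?thesis by simp
qed

section \<open>Reversed polynomials and the annulus count\<close>

text \<open>Reversal turns a nonzero root \<open>a\<close> into \<open>1 / a\<close>, so bounds for
  small roots carry over to large ones. Peeling off one linear factor at a time keeps track of
  multiplicities.\<close>

lemma size_large_roots_le_reflect:
  fixes p :: "complex poly"
  assumes "0 < s"
  shows "size {#x \<in># proots p. cmod x \<ge> 1 / s#} \<le> size {#x \<in># proots (reflect_poly p). cmod x \<le> s#}"
proof (induction "size {#x \<in># proots p. cmod x \<ge> 1 / s#}" arbitrary: p)
  case 0
  show ?case by (simp only: 0[symmetric] zero_le)
next
  case (Suc N)
  have p0: "p \<noteq> 0" using Suc.hyps(2) by auto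
  obtain a where "a \<in># {#x \<in># proots p. cmod x \<ge> 1 / s#}"
    using size_eq_Suc_imp_elem[OF Suc.hyps(2)[symmetric]] by blast
  then have a: "poly p a = 0" "cmod a \<ge> 1 / s"
    using p0 by auto
  then obtain q where q: "p = [:-a, 1:] * q"
    by (auto simp: poly_eq_0_iff_dvd)
  then have q0: "q \<noteq> 0" using p0 by auto
  have a0: "a \<noteq> 0" using a assms by auto
  \<comment> \<open>The left side is the reversal of \<open>z - a\<close>; normalising its leading
    coefficient exhibits the root \<open>1 / a\<close>.\<close>
  have "[:1, -a:] = smult (- a) [:- (1 / a), 1:]"
    using a0 by simp
  then have "proots [:1, -a:] = {#1 / a#}"
    using a0 by (metis add.inverse_inverse neg_equal_0_iff_equal proots_linear_factor proots_smult)
  then have "proots (reflect_poly [:-a, 1:]) = {#1 / a#}"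
    using a0 by (simp add: reflect_poly_def)
  then have "proots (reflect_poly p) = add_mset (1 / a) (proots (reflect_poly q))"
    unfolding q reflect_poly_mult using q0 by (subst proots_mult) auto
  moreover have "cmod (1 / a) \<le> s"
    using a a0 assms by (simp add: norm_divide field_simps)
  moreover have "proots p = add_mset a (proots q)"
    unfolding q using q0 by (subst proots_mult) auto
  ultimately show ?case
    using Suc.hyps a by auto
qed

lemma annulus_zero_count_eq_size:
  assumes "p \<noteq> 0"
  shows "annulus_zero_count p a (ereal b) = size {#x \<in># proots p. a \<le> cmod x \<and> cmod x \<le> b#}"
proof -
  have "size {#x \<in># proots p. a \<le> cmod x \<and> cmod x \<le> b#} =
    (\<Sum>z | poly p z = 0 \<and> a \<le> cmod z \<and> cmod z \<le> b. order z p)"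
    unfolding size_multiset_overloaded_eq
    by (rule sum.cong) (use assms in auto)
  then show ?thesis using assms by (simp add: annulus_zero_count_def)
qed

lemma annulus_zero_count_le_degree: "annulus_zero_count p a (ereal b) \<le> degree p"
proof (cases "p = 0")
  case False
  then show ?thesis
    by (metis annulus_zero_count_eq_size size_filter_mset_lesseq size_proots_complex)
qed (simp add: annulus_zero_count_def)

text \<open>By the fundamental theorem of algebra a nonzero \<open>p\<close> has
  \<open>degree p\<close> roots with multiplicity, and \<open>a \<le> b\<close> makes the three
  regions disjoint.\<close>

lemma degree_le_annulus_zero_count:
  assumes "a \<le> b"
  shows "degree p \<le> annulus_zero_count p a (ereal b)
    + size {#x \<in># proots p. cmod x < a#} + size {#x \<in># proots p. b < cmod x#}"
proof (cases "p = 0")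
  case False
  have "proots p = {#x \<in># proots p. a \<le> cmod x \<and> cmod x \<le> b#}
      + {#x \<in># proots p. cmod x < a#} + {#x \<in># proots p. b < cmod x#}"
    using assms by (intro multiset_eqI) auto
  then show ?thesis
    unfolding annulus_zero_count_eq_size[OF False] by (metis eq_refl size_proots_complex size_union)
qed simp

subsection \<open>Zeros for deterministic coefficient sequences\<close>

text \<open>Under these hypotheses every term on the right of \<open>size_small_roots_le\<close> is
  at most a small multiple of \<open>n\<close>: the index \<open>j\<close>,
  \<open>ln (n + 1)\<close>, \<open>ln A\<close> and \<open>- ln c\<close>.\<close>

lemma eventually_few_small_roots:
  fixes p :: "nat \<Rightarrow> complex poly"
  assumes deg: "\<And>n. degree (p n) \<le> n"
    and growth: "\<And>\<epsilon>. \<epsilon> > 0 \<Longrightarrow> \<forall>\<^sub>F n in sequentially. \<forall>k. cmod (coeff (p n) k) \<le> exp (\<epsilon> * real n)"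
    and large: "\<And>\<epsilon>. \<epsilon> > 0 \<Longrightarrow>
      \<forall>\<^sub>F n in sequentially. \<exists>j. real j \<le> \<epsilon> * real n \<and> c \<le> cmod (coeff (p n) j)"
    and c: "c > 0" and s: "0 < s" "s < 1" and \<epsilon>: "\<epsilon> > 0"
  shows "\<forall>\<^sub>F n in sequentially. real (size {#z \<in># proots (p n). cmod z \<le> s#}) \<le> \<epsilon> * real n"
proof -
  define L where "L = ln ((1 + s\<^sup>2) / (2 * s))"
  \<comment> \<open>The index contributes \<open>ln (1 / s)\<close> and the other three terms
    contribute 1 each, in units of \<open>\<eta> * n\<close>; \<open>\<eta>\<close> is then chosen
    to make the total \<open>\<epsilon> * n * L\<close>.\<close>
  define K where "K = ln (1 / s) + 3"
  have "0 < (1 - s)\<^sup>2" using s by simp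
  then have "2 * s < 1 + s\<^sup>2" by (simp add: power2_eq_square algebra_simps)
  then have L: "L > 0" using s by (simp add: L_def)
  have ln_s: "0 \<le> ln (1 / s)" using s by simp
  have K: "K > 0" using s by (simp add: K_def add_pos_pos)
  define \<eta> where "\<eta> = \<epsilon> * L / K"
  have \<eta>: "\<eta> > 0" using \<epsilon> L K by (simp add: \<eta>_def)
  have ev: "\<forall>\<^sub>F n in sequentially. ln (real (n + 1)) \<le> \<eta> * real n"
    using \<eta> by real_asymp
  have ev': "\<forall>\<^sub>F n in sequentially. - ln c \<le> \<eta> * real n"
    using \<eta> by real_asymp
  show ?thesis
    using growth[OF \<eta>] large[OF \<eta>] ev ev'
  proof eventually_elim
    case (elim n)
    then obtain j where j: "real j \<le> \<eta> * real n" "c \<le> cmod (coeff (p n) j)" by blast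
    let ?N = "real (size {#z \<in># proots (p n). cmod z \<le> s#})"
    have "?N * L \<le> real j * ln (1 / s) + ln (real (n + 1)) + ln (exp (\<eta> * real n)) - ln c"
      unfolding L_def using elim(1) j(2) c s deg by (intro size_small_roots_le) auto
    also have "\<dots> \<le> \<eta> * real n * ln (1 / s) + \<eta> * real n + \<eta> * real n + \<eta> * real n"
      using mult_right_mono[OF j(1) ln_s] elim(3,4) unfolding ln_exp by linarith
    also have "\<dots> = \<eta> * K * real n" by (simp add: K_def algebra_simps)
    also have "\<dots> = \<epsilon> * real n * L" using K by (simp add: \<eta>_def)
    finally show ?case using L by simp
  qed
qed

lemma coeff_sum_monom: "coeff (\<Sum>k\<le>n. monom (x k) k) j = (if j \<le> n then x j else 0)"
  by (simp add: coeff_sum)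

lemma degree_sum_monom_le: "degree (\<Sum>k\<le>n. monom (x k) k) \<le> n"
  by (rule degree_le) (simp add: coeff_sum_monom)

text \<open>Few zeros lie inside the annulus hole, by the estimate for \<open>p n\<close>, and few
  beyond it, by the estimate for the reversal. The degree is at least
  \<open>(1 - \<epsilon>) * n\<close>, so almost all of the \<open>n\<close> possible zeros remain
  in the annulus.\<close>

lemma annulus_zero_count_tendsto_1:
  fixes x :: "nat \<Rightarrow> complex"
  assumes growth: "\<And>\<epsilon>. \<epsilon> > 0 \<Longrightarrow> \<forall>\<^sub>F n in sequentially. \<forall>k\<le>n. cmod (x k) \<le> exp (\<epsilon> * real n)"
    and large: "\<And>\<epsilon>. \<epsilon> > 0 \<Longrightarrow>
      \<forall>\<^sub>F n in sequentially. \<exists>m\<le>n. (1 - \<epsilon>) * real n \<le> real m \<and> c \<le> cmod (x m)"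
    and c: "c > 0" and \<delta>: "\<delta> > 0"
  shows "(\<lambda>n. real (annulus_zero_count (\<Sum>k\<le>n. monom (x k) k) (1 - \<delta>) (ereal (1 + \<delta>))) / real n)
    \<longlonglongrightarrow> 1"
proof -
  define p where "p n = (\<Sum>k\<le>n. monom (x k) k)" for n
  have coeff_p: "coeff (p n) j = (if j \<le> n then x j else 0)" for n j
    by (simp add: p_def coeff_sum_monom)
  have deg: "degree (p n) \<le> n" for n by (simp add: p_def degree_sum_monom_le)
  have growth_p: "\<forall>\<^sub>F n in sequentially. \<forall>k. cmod (coeff (p n) k) \<le> exp (\<epsilon> * real n)" if "\<epsilon> > 0" for \<epsilon>
    using growth[OF that] by eventually_elim (auto simp: coeff_p)
  have growth_reflect: "\<forall>\<^sub>F n in sequentially. \<forall>k. cmod (coeff (reflect_poly (p n)) k) \<le> exp (\<epsilon> * real n)"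
    if "\<epsilon> > 0" for \<epsilon>
    using growth_p[OF that] by eventually_elim (auto simp: coeff_reflect_poly)
  \<comment> \<open>One fixed index suffices for small roots, since eventually
    \<open>m0 \<le> \<epsilon> * n\<close>.\<close>
  obtain m0 where m0: "c \<le> cmod (x m0)"
    using eventually_happens[OF large[of 1]] by auto
  have large_p: "\<forall>\<^sub>F n in sequentially. \<exists>j. real j \<le> \<epsilon> * real n \<and> c \<le> cmod (coeff (p n) j)"
    if "\<epsilon> > 0" for \<epsilon>
  proof -
    have "\<forall>\<^sub>F n in sequentially. real m0 \<le> \<epsilon> * real n" using that by real_asymp
    then show ?thesis using eventually_ge_at_top[of m0]
      by eventually_elim (use m0 in \<open>auto simp: coeff_p intro!: exI[of _ m0]\<close>)
  qed
  have large_reflect: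
    "\<forall>\<^sub>F n in sequentially. \<exists>j. real j \<le> \<epsilon> * real n \<and> c \<le> cmod (coeff (reflect_poly (p n)) j)"
    if "\<epsilon> > 0" for \<epsilon>
    using large[OF that]
  proof eventually_elim
    case (elim n)
    then obtain m where m: "m \<le> n" "(1 - \<epsilon>) * real n \<le> real m" "c \<le> cmod (x m)" by blast
    then have "coeff (p n) m \<noteq> 0" using c by (auto simp: coeff_p)
    then have "m \<le> degree (p n)" by (rule le_degree)
    then show ?case
      \<comment> \<open>Reversal moves index \<open>m\<close> to \<open>degree (p n) - m\<close>,
        which is at most \<open>n - m\<close> and hence at most
        \<open>\<epsilon> * n\<close>.\<close>
      using m deg[of n] by (intro exI[of _ "degree (p n) - m"])
        (auto simp: coeff_reflect_poly coeff_p of_nat_diff algebra_simps)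
  qed
  \<comment> \<open>The maximum with 1/2 keeps the radius positive when
    \<open>\<delta> \<ge> 1\<close>.\<close>
  have few_p: "\<forall>\<^sub>F n in sequentially.
      real (size {#z \<in># proots (p n). cmod z \<le> max (1/2) (1 - \<delta>)#}) \<le> \<epsilon> * real n" if "\<epsilon> > 0" for \<epsilon>
    by (rule eventually_few_small_roots[OF deg growth_p large_p c _ _ that]) (use \<delta> in auto)
  have few_reflect: "\<forall>\<^sub>F n in sequentially.
      real (size {#z \<in># proots (reflect_poly (p n)). cmod z \<le> 1 / (1 + \<delta>)#}) \<le> \<epsilon> * real n" if "\<epsilon> > 0" for \<epsilon>
    by (rule eventually_few_small_roots[OF order_trans[OF degree_reflect_poly_le deg]
          growth_reflect large_reflect c _ _ that]) (use \<delta> in auto)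
  have inner: "\<forall>\<^sub>F n in sequentially. real (size {#z \<in># proots (p n). cmod z < 1 - \<delta>#}) \<le> \<epsilon> * real n"
    if "\<epsilon> > 0" for \<epsilon>
    using few_p[OF that]
  proof eventually_elim
    case (elim n)
    have "{#z \<in># proots (p n). cmod z < 1 - \<delta>#} \<subseteq># {#z \<in># proots (p n). cmod z \<le> max (1/2) (1 - \<delta>)#}"
      by (rule filter_mset_mono_strong) auto
    then show ?case using elim by (meson of_nat_le_iff order_trans size_mset_mono)
  qed
  have outer: "\<forall>\<^sub>F n in sequentially. real (size {#z \<in># proots (p n). 1 + \<delta> < cmod z#}) \<le> \<epsilon> * real n"
    if "\<epsilon> > 0" for \<epsilon>
    using few_reflect[OF that]
  proof eventually_elim
    case (elim n)
    have "size {#z \<in># proots (p n). 1 + \<delta> < cmod z#} \<le> size {#z \<in># proots (p n). 1 / (1 / (1 + \<delta>)) \<le> cmod z#}"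
      by (intro size_mset_mono filter_mset_mono_strong) auto
    also have "\<dots> \<le> size {#z \<in># proots (reflect_poly (p n)). cmod z \<le> 1 / (1 + \<delta>)#}"
      using \<delta> by (intro size_large_roots_le_reflect) simp
    finally show ?case using elim by linarith
  qed
  show ?thesis
    unfolding p_def[symmetric]
  proof (rule tendstoI)
    fix e :: real assume e: "e > 0"
    \<comment> \<open>Three losses of \<open>e / 4 * n\<close> each, from the degree, the inner
      zeros and the outer zeros, total less than \<open>e * n\<close>.\<close>
    then have e4: "e / 4 > 0" by simp
    show "\<forall>\<^sub>F n in sequentially.
      dist (real (annulus_zero_count (p n) (1 - \<delta>) (ereal (1 + \<delta>))) / real n) 1 < e"
      using inner[OF e4] outer[OF e4] large[OF e4] eventually_gt_at_top[of 0]
    proof eventually_elim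
      case (elim n)
      let ?R = "annulus_zero_count (p n) (1 - \<delta>) (ereal (1 + \<delta>))"
      obtain m where m: "m \<le> n" "(1 - e / 4) * real n \<le> real m" "c \<le> cmod (x m)"
        using elim(3) by blast
      then have "coeff (p n) m \<noteq> 0" using c by (auto simp: coeff_p)
      then have "m \<le> degree (p n)" by (rule le_degree)
      also have "\<dots> \<le> ?R + size {#z \<in># proots (p n). cmod z < 1 - \<delta>#}
          + size {#z \<in># proots (p n). 1 + \<delta> < cmod z#}"
        using \<delta> by (intro degree_le_annulus_zero_count) simp
      finally have "(1 - e / 4) * real n \<le> real ?R + e / 4 * real n + e / 4 * real n"
        using elim(1,2) m(2) by linarith
      then have "(1 - 3 / 4 * e) * real n \<le> real ?R" by (simp add: algebra_simps)
      then have "1 - 3 / 4 * e \<le> real ?R / real n" using elim(4) by (simp add: field_simps)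
      moreover have "real ?R / real n \<le> 1"
        using order_trans[OF annulus_zero_count_le_degree deg, of n] elim(4) by simp
      ultimately show ?case using e by (simp add: dist_real_def)
    qed
  qed
qed

lemma eventually_all_le_exp:
  fixes x :: "nat \<Rightarrow> complex"
  assumes "\<And>\<epsilon>. \<epsilon> > 0 \<Longrightarrow> \<forall>\<^sub>F n in sequentially. cmod (x n) \<le> exp (\<epsilon> * real n)" and "\<epsilon> > 0"
  shows "\<forall>\<^sub>F n in sequentially. \<forall>k\<le>n. cmod (x k) \<le> exp (\<epsilon> * real n)"
proof -
  obtain N where N: "\<And>n. n \<ge> N \<Longrightarrow> cmod (x n) \<le> exp (\<epsilon> * real n)"
    using assms by (auto simp: eventually_sequentially)
  define B where "B = (\<Sum>k<N. cmod (x k))"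
  have "\<forall>\<^sub>F n in sequentially. B \<le> exp (\<epsilon> * real n)"
    using assms(2) by real_asymp
  then show ?thesis
  proof eventually_elim
    case (elim n)
    show ?case
    proof (intro allI impI)
      fix k assume "k \<le> n"
      show "cmod (x k) \<le> exp (\<epsilon> * real n)"
      proof (cases "k < N")
        case True
        then have "cmod (x k) \<le> B" unfolding B_def by (intro member_le_sum) auto
        with elim show ?thesis by linarith
      next
        case False
        then have "cmod (x k) \<le> exp (\<epsilon> * real k)" by (intro N) simp
        also have "\<dots> \<le> exp (\<epsilon> * real n)" using \<open>k \<le> n\<close> assms(2) by simp
        finally show ?thesis .
      qed
    qed
  qed
qed

section \<open>Sequences with a dominating leading term\<close>

text \<open>With ratio at least 2, two copies of \<open>t ^ n\<close> fit into the next power. The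
  constant term \<open>b\<close> is kept apart because it need not be bounded by
  \<open>t ^ 0\<close>.\<close>

lemma leading_term_dominates:
  fixes t :: real
  assumes "2 \<le> t" "b < t" "1 \<le> n"
  shows "b + (\<Sum>k=1..<n. t ^ k) < t ^ n"
  using assms(3)
proof (induction n rule: dec_induct)
  case (step n)
  have "b + (\<Sum>k=1..<Suc n. t ^ k) < t ^ n + t ^ n" using step by simp
  also have "\<dots> \<le> t ^ Suc n" using assms(1) by simp
  finally show ?case .
qed (use assms in simp)

text \<open>For |z| at least 1/2 the number \<open>t = \<rho> * cmod z\<close> is at least 2 and
  exceeds \<open>cmod (x 0)\<close>, which is what the two conditions on \<open>\<rho>\<close>
  secure; the leading term \<open>t ^ n\<close> then cannot be cancelled.\<close>

lemma annulus_zero_count_dominant: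
  fixes x :: "nat \<Rightarrow> complex"
  assumes n: "1 \<le> n" and \<rho>: "4 \<le> \<rho>" "2 * cmod (x 0) < \<rho>"
    and le: "\<And>k. 1 \<le> k \<Longrightarrow> k < n \<Longrightarrow> cmod (x k) \<le> \<rho> ^ k" and eq: "cmod (x n) = \<rho> ^ n"
  shows "annulus_zero_count (\<Sum>k\<le>n. monom (x k) k) (1/2) b = 0"
proof -
  have "poly (\<Sum>k\<le>n. monom (x k) k) z \<noteq> 0" if z: "1/2 \<le> cmod z" for z
  proof
    assume "poly (\<Sum>k\<le>n. monom (x k) k) z = 0"
    then have "(\<Sum>k<n. x k * z ^ k) + x n * z ^ n = 0"
      by (simp add: poly_sum poly_monom flip: lessThan_Suc_atMost)
    then have "x n * z ^ n = - (\<Sum>k<n. x k * z ^ k)"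
      by (simp add: eq_neg_iff_add_eq_0 add.commute)
    then have "cmod (x n * z ^ n) = cmod (\<Sum>k<n. x k * z ^ k)" by simp
    then have "(\<rho> * cmod z) ^ n = cmod (\<Sum>k<n. x k * z ^ k)"
      by (simp add: norm_mult norm_power eq power_mult_distrib)
    also have "\<dots> \<le> (\<Sum>k<n. cmod (x k) * cmod z ^ k)"
      by (rule order_trans[OF norm_sum]) (simp add: norm_mult norm_power)
    also have "\<dots> = cmod (x 0) + (\<Sum>k=1..<n. cmod (x k) * cmod z ^ k)"
      using n by (simp add: lessThan_atLeast0 sum.atLeast_Suc_lessThan)
    also have "\<dots> \<le> cmod (x 0) + (\<Sum>k=1..<n. (\<rho> * cmod z) ^ k)"
      using le by (auto intro!: sum_mono mult_right_mono simp: power_mult_distrib)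
    also have "\<dots> < (\<rho> * cmod z) ^ n"
    proof (rule leading_term_dominates[OF _ _ n])
      have "\<rho> * (1/2) \<le> \<rho> * cmod z" using z \<rho> by (intro mult_left_mono) auto
      then show "2 \<le> \<rho> * cmod z" "cmod (x 0) < \<rho> * cmod z" using \<rho> by linarith+
    qed
    finally show False by simp
  qed
  then have "{z. poly (\<Sum>k\<le>n. monom (x k) k) z = 0 \<and> 1/2 \<le> cmod z \<and> ereal (cmod z) \<le> b} = {}"
    by auto
  then show ?thesis unfolding annulus_zero_count_def by (simp only: sum.empty if_cancel)
qed

text \<open>At a record of \<open>root n (cmod (x n))\<close> the leading term dominates all others on \<open>cmod z \<ge> 1/2\<close>.\<close>

lemma annulus_zero_count_frequently_0:
  fixes x :: "nat \<Rightarrow> complex"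
  assumes "\<And>C::real. C \<ge> 0 \<Longrightarrow> \<exists>n\<ge>1. C ^ n < cmod (x n)"
  shows "\<exists>n\<ge>N. annulus_zero_count (\<Sum>k\<le>n. monom (x k) k) (1/2) b = 0"
proof -
  define y where "y k = root k (cmod (x k))" for k
  \<comment> \<open>The first two summands meet the thresholds for \<open>\<rho>\<close>; the sum
    forces any \<open>n\<close> with \<open>y n > B\<close> beyond \<open>N\<close>. As
    \<open>root 0\<close> is zero, \<open>y 0\<close> says nothing about \<open>x 0\<close>, which
    enters directly.\<close>
  define B where "B = 4 + 2 * cmod (x 0) + (\<Sum>k\<le>N. y k)"
  have y0: "y k \<ge> 0" for k by (cases "k = 0") (auto simp: y_def)
  have B: "B \<ge> 4 + 2 * cmod (x 0)" unfolding B_def using y0 by (simp add: sum_nonneg)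
  have yN: "y k \<le> B" if "k \<le> N" for k
  proof -
    have "y k \<le> (\<Sum>k\<le>N. y k)" using that y0 by (intro member_le_sum) auto
    then show ?thesis unfolding B_def by (smt (verit) norm_ge_zero)
  qed
  have ypow: "y k ^ k = cmod (x k)" if "k \<ge> 1" for k
    using that by (simp add: y_def)
  have "\<exists>n. 1 \<le> n \<and> B < y n"
  proof -
    obtain n where n: "n \<ge> 1" "B ^ n < cmod (x n)" using assms[of B] B by (smt (verit) norm_ge_zero)
    then have "B ^ n < y n ^ n" by (simp add: ypow)
    then show ?thesis using n(1) y0 power_less_imp_less_base by blast
  qed
  \<comment> \<open>The first passage above \<open>B\<close> is a record: all earlier
    \<open>y k\<close> with \<open>k \<ge> 1\<close> are at most \<open>B\<close>.\<close>
  then obtain n where n: "1 \<le> n" "B < y n" and least: "\<And>k. k < n \<Longrightarrow> \<not> (1 \<le> k \<and> B < y k)"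
    using exists_least_iff[of "\<lambda>n. 1 \<le> n \<and> B < y n"] by blast
  have "N \<le> n" using n(2) yN by (meson linorder_not_less nat_le_linear)
  moreover have "annulus_zero_count (\<Sum>k\<le>n. monom (x k) k) (1/2) b = 0"
  proof (rule annulus_zero_count_dominant[OF n(1), of "y n"])
    show "4 \<le> y n" "2 * cmod (x 0) < y n"
      using n(2) B norm_ge_zero[of "x 0"] by linarith+
    show "cmod (x k) \<le> y n ^ k" if "1 \<le> k" "k < n" for k
      using least[OF that(2)] that n(2) y0[of k]
      by (subst ypow[symmetric]) (auto intro!: power_mono)
  qed (use ypow n in simp)
  ultimately show ?thesis by blast
qed

subsection \<open>Independent sequences\<close>

context prob_space
begin

text \<open>Tail-sum formula for the integer variable \<open>f\<close>, the ceiling of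
  \<open>X / \<epsilon>\<close>, which differs from \<open>X / \<epsilon>\<close> by at most 1. It
  links the moment condition to the Borel-Cantelli lemmas at every scale
  \<open>\<epsilon>\<close>.\<close>

lemma nn_integral_finite_iff_summable:
  assumes [measurable]: "X \<in> borel_measurable M" and X: "\<And>\<omega>. 0 \<le> X \<omega>" and \<epsilon>: "\<epsilon> > (0::real)"
  shows "(\<integral>\<^sup>+\<omega>. ennreal (X \<omega>) \<partial>M) < \<infinity> \<longleftrightarrow>
    summable (\<lambda>n. prob {\<omega> \<in> space M. \<epsilon> * real n < X \<omega>})"
proof -
  define f where "f \<omega> = nat \<lceil>X \<omega> / \<epsilon>\<rceil>" for \<omega>
  have [measurable]: "f \<in> measurable M (count_space UNIV)"
    unfolding f_def by measurable
  have "n < f \<omega> \<longleftrightarrow> \<epsilon> * real n < X \<omega>" for n \<omega>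
    using \<epsilon> by (simp add: f_def zless_nat_eq_int_zless less_ceiling_iff pos_less_divide_eq mult.commute)
  then have "(\<integral>\<^sup>+\<omega>. of_nat (f \<omega>) \<partial>M) = (\<Sum>n. ennreal (prob {\<omega> \<in> space M. \<epsilon> * real n < X \<omega>}))"
    by (simp add: nn_integral_nat_function emeasure_eq_measure)
  moreover have "(\<Sum>n. ennreal (prob {\<omega> \<in> space M. \<epsilon> * real n < X \<omega>})) < \<infinity> \<longleftrightarrow>
    summable (\<lambda>n. prob {\<omega> \<in> space M. \<epsilon> * real n < X \<omega>})"
    (is "?lhs \<longleftrightarrow> ?rhs")
  proof
    show ?rhs if ?lhs using that by (intro summable_suminf_not_top) auto
    show ?lhs if ?rhs using ennreal_suminf_neq_top[OF that] by (simp only: less_top infinity_ennreal_def measure_nonneg)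
  qed
  moreover have "(\<integral>\<^sup>+\<omega>. ennreal (X \<omega>) \<partial>M) < \<infinity> \<longleftrightarrow> (\<integral>\<^sup>+\<omega>. of_nat (f \<omega>) \<partial>M) < \<infinity>"
  proof
    assume fin: "(\<integral>\<^sup>+\<omega>. ennreal (X \<omega>) \<partial>M) < \<infinity>"
    have "(\<integral>\<^sup>+\<omega>. of_nat (f \<omega>) \<partial>M) \<le> (\<integral>\<^sup>+\<omega>. ennreal (1 / \<epsilon>) * ennreal (X \<omega>) + 1 \<partial>M)"
    proof (intro nn_integral_mono)
      fix \<omega>
      have "real (f \<omega>) \<le> 1 / \<epsilon> * X \<omega> + 1"
        using X[of \<omega>] \<epsilon> by (simp add: f_def)
      then have "ennreal (real (f \<omega>)) \<le> ennreal (1 / \<epsilon> * X \<omega> + 1)" by (rule ennreal_leI)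
      then show "of_nat (f \<omega>) \<le> ennreal (1 / \<epsilon>) * ennreal (X \<omega>) + 1"
        using X[of \<omega>] \<epsilon> by (simp add: ennreal_of_nat_eq_real_of_nat ennreal_plus ennreal_mult del: times_divide_eq_left mult_1_left flip: ennreal_1)
    qed
    also have "\<dots> = ennreal (1 / \<epsilon>) * (\<integral>\<^sup>+\<omega>. ennreal (X \<omega>) \<partial>M) + 1"
      by (simp add: nn_integral_add nn_integral_cmult emeasure_space_1)
    also have "\<dots> < \<infinity>" using fin by (simp add: ennreal_mult_less_top)
    finally show "(\<integral>\<^sup>+\<omega>. of_nat (f \<omega>) \<partial>M) < \<infinity>" .
  next
    assume fin: "(\<integral>\<^sup>+\<omega>. of_nat (f \<omega>) \<partial>M) < \<infinity>"
    have "(\<integral>\<^sup>+\<omega>. ennreal (X \<omega>) \<partial>M) \<le> (\<integral>\<^sup>+\<omega>. ennreal \<epsilon> * of_nat (f \<omega>) \<partial>M)"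
    proof (intro nn_integral_mono)
      fix \<omega>
      have "X \<omega> / \<epsilon> \<le> real (f \<omega>)" unfolding f_def by (rule real_nat_ceiling_ge)
      then have "X \<omega> \<le> \<epsilon> * real (f \<omega>)" using \<epsilon> by (simp add: field_simps)
      then have "ennreal (X \<omega>) \<le> ennreal (\<epsilon> * real (f \<omega>))" by (rule ennreal_leI)
      then show "ennreal (X \<omega>) \<le> ennreal \<epsilon> * of_nat (f \<omega>)"
        using \<epsilon> by (simp add: ennreal_mult ennreal_of_nat_eq_real_of_nat)
    qed
    also have "\<dots> = ennreal \<epsilon> * (\<integral>\<^sup>+\<omega>. of_nat (f \<omega>) \<partial>M)"
      by (simp add: nn_integral_cmult)
    also have "\<dots> < \<infinity>" using fin by (simp add: ennreal_mult_less_top)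
    finally show "(\<integral>\<^sup>+\<omega>. ennreal (X \<omega>) \<partial>M) < \<infinity>" .
  qed
  ultimately show ?thesis by simp
qed

text \<open>Second Borel-Cantelli argument: by independence and 1 - q \<le> exp(-q), missing all
  events up to \<open>k\<close> has probability at most the exponential of minus a partial sum. A
  positive probability of missing them all would bound these sums.\<close>

lemma AE_ex_if_not_summable:
  fixes X :: "nat \<Rightarrow> 'a \<Rightarrow> 'b"
  assumes indep: "indep_vars (\<lambda>_. N) X UNIV" and S [measurable]: "\<And>n. S n \<in> sets N"
    and div: "\<not> summable (\<lambda>n. prob {\<omega> \<in> space M. X n \<omega> \<in> S n})"
  shows "AE \<omega> in M. \<exists>n\<ge>m. X n \<omega> \<in> S n"
proof -
  have X [measurable]: "X n \<in> measurable M N" for n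
    using indep by (auto simp: indep_vars_def)
  define q where "q n = prob {\<omega> \<in> space M. X n \<omega> \<in> S n}" for n
  define E where "E = {\<omega> \<in> space M. \<forall>n\<ge>m. X n \<omega> \<notin> S n}"
  have E [measurable]: "E \<in> sets M" unfolding E_def by measurable
  have bound: "prob E \<le> exp (- (\<Sum>n=m..<k. q n))" if "m < k" for k
  proof -
    have "E \<subseteq> (\<Inter>n\<in>{m..<k}. X n -` (space N - S n) \<inter> space M)"
      unfolding E_def using that by (auto intro: measurable_space[OF X])
    then have "prob E \<le> prob (\<Inter>n\<in>{m..<k}. X n -` (space N - S n) \<inter> space M)"
      using that by (intro finite_measure_mono) auto
    also have "\<dots> = (\<Prod>n=m..<k. prob (X n -` (space N - S n) \<inter> space M))"
      by (rule indep_varsD[OF indep]) (use that in auto)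
    also have "\<dots> = (\<Prod>n=m..<k. 1 - q n)"
    proof (rule prod.cong)
      fix n
      have "X n -` (space N - S n) \<inter> space M = space M - {\<omega> \<in> space M. X n \<omega> \<in> S n}"
        by (auto intro: measurable_space[OF X])
      then show "prob (X n -` (space N - S n) \<inter> space M) = 1 - q n"
        by (simp add: q_def prob_compl)
    qed simp
    also have "\<dots> \<le> (\<Prod>n=m..<k. exp (- q n))"
      using exp_ge_add_one_self[of "- q _"] by (intro prod_mono) (auto simp: q_def)
    also have "\<dots> = exp (- (\<Sum>n=m..<k. q n))"
      by (simp add: exp_sum sum_negf[symmetric])
    finally show ?thesis .
  qed
  have "prob E \<le> 0"
  proof (rule ccontr)
    assume "\<not> prob E \<le> 0"
    then have pos: "prob E > 0" by simp
    have "(\<Sum>n=m..<k. q n) \<le> - ln (prob E)" if "m < k" for k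
    proof -
      have "ln (prob E) \<le> ln (exp (- (\<Sum>n=m..<k. q n)))"
        using bound[OF that] pos by (subst ln_le_cancel_iff) auto
      then show ?thesis by simp
    qed
    then have "sum (\<lambda>n. q (n + m)) {..<k} \<le> - ln (prob E)" if "k > 0" for k
      using that sum.shift_bounds_nat_ivl[of q 0 m k] by (simp add: lessThan_atLeast0) (metis less_add_same_cancel2)
    then have "sum (\<lambda>n. q (n + m)) {..<k} \<le> max 0 (- ln (prob E))" for k
      by (cases "k = 0") (auto simp: le_max_iff_disj)
    then have "summable (\<lambda>n. q (n + m))"
      by (rule summableI_nonneg_bounded[rotated]) (simp add: q_def)
    then show False unfolding summable_iff_shift using div by (simp add: q_def[abs_def])
  qed
  then have "E \<in> null_sets M"
    using E by (simp add: null_sets_def emeasure_eq_measure measure_le_0_iff)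
  then show ?thesis
    by (rule AE_I') (auto simp: E_def)
qed

text \<open>A block of about \<open>n / K\<close> indices is missed with probability at most
  \<open>r ^ n\<close>, where \<open>r\<close> is the \<open>K\<close>-th root of \<open>q\<close>;
  this is summable, so the first Borel-Cantelli lemma applies.\<close>

lemma AE_eventually_block_hit:
  fixes X :: "nat \<Rightarrow> 'a \<Rightarrow> 'b"
  assumes indep: "indep_vars (\<lambda>_. N) X UNIV" and S [measurable]: "S \<in> sets N"
    and q: "\<And>n. prob {\<omega> \<in> space M. X n \<omega> \<notin> S} = q" "q < 1" and K: "K > 0"
  shows "AE \<omega> in M. \<forall>\<^sub>F n in sequentially. \<exists>m\<in>{n - n div K..n}. X m \<omega> \<in> S"
proof -
  have X [measurable]: "X n \<in> measurable M N" for n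
    using indep by (auto simp: indep_vars_def)
  have q0: "0 \<le> q" using q(1)[of 0] by (metis measure_nonneg)
  define A where "A n = (\<Inter>m\<in>{n - n div K..n}. X m -` (space N - S) \<inter> space M)" for n
  have A [measurable]: "A n \<in> sets M" for n
    unfolding A_def by (intro sets.finite_INT) auto
  define r where "r = root K q"
  have r: "0 \<le> r" "r < 1" "r ^ K = q"
    using q0 q(2) K real_root_lt_1_iff[of K q] by (auto simp: r_def)
  have "prob (A n) \<le> r ^ n" for n
  proof -
    have "prob (A n) = (\<Prod>m\<in>{n - n div K..n}. prob (X m -` (space N - S) \<inter> space M))"
      unfolding A_def by (rule indep_varsD[OF indep]) auto
    also have "\<dots> = (\<Prod>m\<in>{n - n div K..n}. q)"
    proof (rule prod.cong)
      fix m
      have "X m -` (space N - S) \<inter> space M = {\<omega> \<in> space M. X m \<omega> \<notin> S}"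
        by (auto intro: measurable_space[OF X])
      then show "prob (X m -` (space N - S) \<inter> space M) = q"
        by (simp add: q(1))
    qed simp
    \<comment> \<open>The block has \<open>n div K + 1\<close> elements, and the extra one makes the
      exponent exceed \<open>n\<close>.\<close>
    also have "\<dots> = r ^ (K * (n div K + 1))"
      using div_le_dividend[of n K] by (simp only: power_mult r) (simp add: Suc_diff_le)
    also have "\<dots> \<le> r ^ n"
      using r K by (intro power_decreasing) (auto simp: less_imp_le dividend_less_times_div)
    finally show ?thesis .
  qed
  moreover have "summable (\<lambda>n. r ^ n)" using r by (intro summable_geometric) auto
  ultimately have "summable (\<lambda>n. prob (A n))"
    using summable_comparison_test'[where N = 0 and g = "\<lambda>n. r ^ n" and f = "\<lambda>n. prob (A n)"] by simp
  then have "AE \<omega> in M. \<forall>\<^sub>F n in sequentially. \<omega> \<in> space M - A n"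
    by (intro borel_cantelli_AE1) (auto simp: emeasure_eq_measure)
  then show ?thesis
  proof eventually_elim
    case (elim \<omega>)
    then show ?case
      by eventually_elim (auto simp: A_def intro: measurable_space[OF X])
  qed
qed

text \<open>If every threshold 1/(n+1) failed, countably many almost sure bounds would force
  \<open>X = 0\<close> almost surely.\<close>

lemma prob_bounded_away_from_0:
  fixes X :: "'a \<Rightarrow> 'b :: {real_normed_vector, second_countable_topology}"
  assumes [measurable]: "X \<in> borel_measurable M" and "prob {\<omega> \<in> space M. X \<omega> = 0} < 1"
  obtains c where "c > 0" "prob {\<omega> \<in> space M. norm (X \<omega>) < c} < 1"
proof (rule ccontr)
  assume "\<not> thesis"
  then have "prob {\<omega> \<in> space M. norm (X \<omega>) < inverse (real (Suc n))} = 1" for n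
    using that prob_le_1 by (metis inverse_positive_iff_positive of_nat_0_less_iff order_le_less zero_less_Suc)
  then have "AE \<omega> in M. norm (X \<omega>) < inverse (real (Suc n))" for n
    by (subst (asm) prob_Collect_eq_1) auto
  then have "AE \<omega> in M. \<forall>n. norm (X \<omega>) < inverse (real (Suc n))"
    by (simp add: AE_all_countable)
  then have "AE \<omega> in M. X \<omega> = 0"
  proof eventually_elim
    case (elim \<omega>)
    then show ?case by (metis order_less_asym reals_Archimedean zero_less_norm_iff)
  qed
  then have "prob {\<omega> \<in> space M. X \<omega> = 0} = 1"
    by (subst prob_Collect_eq_1) auto
  with assms(2) show False by simp
qed

end

subsection \<open>Random coefficients\<close>

context prob_space
begin

context
  fixes \<xi> :: "nat \<Rightarrow> 'a \<Rightarrow> complex"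
  assumes indep: "indep_vars (\<lambda>_. borel) \<xi> UNIV"
    and ident: "\<And>k. distr M borel (\<xi> k) = distr M borel (\<xi> 0)"
begin

lemma measurable_coeff [measurable]: "\<xi> k \<in> borel_measurable M"
  using indep by (auto simp: indep_vars_def)

lemma prob_coeff_eq:
  assumes [measurable]: "Measurable.pred borel P"
  shows "prob {\<omega> \<in> space M. P (\<xi> k \<omega>)} = prob {\<omega> \<in> space M. P (\<xi> 0 \<omega>)}"
proof -
  have "prob {\<omega> \<in> space M. P (\<xi> j \<omega>)} = measure (distr M borel (\<xi> j)) {x. P x}" for j
    by (subst measure_distr) (auto intro!: arg_cong[where f = prob])
  then show ?thesis by (metis ident)
qed

section \<open>Finite logarithmic moment\<close>

text \<open>The moment gives summable tails for \<open>\<xi> 0\<close>; equal distribution transfers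
  them to \<open>\<xi> n\<close>, and the first Borel-Cantelli lemma concludes.\<close>

lemma AE_root_test_le:
  assumes "(\<integral>\<^sup>+\<omega>. ennreal (ln (1 + cmod (\<xi> 0 \<omega>))) \<partial>M) < \<infinity>" and \<epsilon>: "\<epsilon> > 0"
  shows "AE \<omega> in M. \<forall>\<^sub>F n in sequentially. cmod (\<xi> n \<omega>) \<le> exp (\<epsilon> * real n)"
proof -
  have "summable (\<lambda>n. prob {\<omega> \<in> space M. \<epsilon> * real n < ln (1 + cmod (\<xi> 0 \<omega>))})"
    using assms by (subst nn_integral_finite_iff_summable[symmetric]) auto
  also have "(\<lambda>n. prob {\<omega> \<in> space M. \<epsilon> * real n < ln (1 + cmod (\<xi> 0 \<omega>))}) =
    (\<lambda>n. prob {\<omega> \<in> space M. \<epsilon> * real n < ln (1 + cmod (\<xi> n \<omega>))})"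
    by (intro ext prob_coeff_eq[symmetric]) measurable
  finally have "AE \<omega> in M. \<forall>\<^sub>F n in sequentially.
      \<omega> \<in> space M - {\<omega> \<in> space M. \<epsilon> * real n < ln (1 + cmod (\<xi> n \<omega>))}"
    by (intro borel_cantelli_AE1) (auto simp: emeasure_eq_measure)
  then show ?thesis
  proof eventually_elim
    case (elim \<omega>)
    then show ?case
    proof eventually_elim
      case (elim n)
      then have "ln (1 + cmod (\<xi> n \<omega>)) \<le> \<epsilon> * real n" by auto
      then have "1 + cmod (\<xi> n \<omega>) \<le> exp (\<epsilon> * real n)"
        by (metis add_pos_nonneg exp_le_cancel_iff exp_ln norm_ge_zero zero_less_one)
      then show ?case by simp
    qed
  qed
qed

text \<open>A single \<open>c\<close> works for all \<open>\<epsilon>\<close>; taking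
  \<open>1 / K < \<epsilon>\<close> places the block of \<open>AE_eventually_block_hit\<close>
  inside the required window.\<close>

lemma AE_large_coeff:
  assumes "prob {\<omega> \<in> space M. \<xi> 0 \<omega> = 0} < 1"
  obtains c where "c > 0"
    and "\<And>\<epsilon>. \<epsilon> > 0 \<Longrightarrow> AE \<omega> in M. \<forall>\<^sub>F n in sequentially.
      \<exists>m\<le>n. (1 - \<epsilon>) * real n \<le> real m \<and> c \<le> cmod (\<xi> m \<omega>)"
proof -
  obtain c where c: "c > 0" "prob {\<omega> \<in> space M. cmod (\<xi> 0 \<omega>) < c} < 1"
    using prob_bounded_away_from_0[of "\<xi> 0"] assms by auto
  have "AE \<omega> in M. \<forall>\<^sub>F n in sequentially. \<exists>m\<le>n. (1 - \<epsilon>) * real n \<le> real m \<and> c \<le> cmod (\<xi> m \<omega>)"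
    if \<epsilon>: "\<epsilon> > 0" for \<epsilon> :: real
  proof -
    obtain K where K: "K > 0" "inverse (real K) < \<epsilon>"
      using ex_inverse_of_nat_less[OF \<epsilon>] by blast
    have "AE \<omega> in M. \<forall>\<^sub>F n in sequentially. \<exists>m\<in>{n - n div K..n}. \<xi> m \<omega> \<in> {z. c \<le> cmod z}"
    proof (rule AE_eventually_block_hit[OF indep _ _ c(2) K(1)])
      show "prob {\<omega> \<in> space M. \<xi> n \<omega> \<notin> {z. c \<le> cmod z}} = prob {\<omega> \<in> space M. cmod (\<xi> 0 \<omega>) < c}" for n
        using prob_coeff_eq[of "\<lambda>z. cmod z < c" n] by (simp add: not_le)
    qed measurable
    then show ?thesis
    proof eventually_elim
      case (elim \<omega>)
      then show ?case
      proof eventually_elim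
        case (elim n)
        then obtain m where m: "n - n div K \<le> m" "m \<le> n" "c \<le> cmod (\<xi> m \<omega>)" by auto
        have "real (n div K) \<le> real n / real K" by (rule of_nat_div_le_of_nat)
        also have "\<dots> \<le> \<epsilon> * real n"
          using K mult_right_mono[of "inverse (real K)" \<epsilon> "real n"] by (simp add: field_simps)
        finally have "(1 - \<epsilon>) * real n \<le> real n - real (n div K)" by (simp add: algebra_simps)
        also have "\<dots> \<le> real m" using m(1) by linarith
        finally show ?case using m by blast
      qed
    qed
  qed
  with c(1) that show ?thesis by blast
qed

lemma AE_annulus_zero_count_tendsto_1:
  assumes "(\<integral>\<^sup>+\<omega>. ennreal (ln (1 + cmod (\<xi> 0 \<omega>))) \<partial>M) < \<infinity>"
    and "prob {\<omega> \<in> space M. \<xi> 0 \<omega> = 0} < 1" and \<delta>: "\<delta> > 0"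
  shows "AE \<omega> in M.
    (\<lambda>n. real (annulus_zero_count (random_poly \<xi> n \<omega>) (1 - \<delta>) (ereal (1 + \<delta>))) / real n) \<longlonglongrightarrow> 1"
proof -
  obtain c where c: "c > 0"
    and large: "\<And>\<epsilon>. \<epsilon> > 0 \<Longrightarrow> AE \<omega> in M. \<forall>\<^sub>F n in sequentially.
      \<exists>m\<le>n. (1 - \<epsilon>) * real n \<le> real m \<and> c \<le> cmod (\<xi> m \<omega>)"
    using AE_large_coeff[OF assms(2)] by blast
  \<comment> \<open>The null set depends on \<open>\<epsilon>\<close>; restricting to the values
    1/(i+1) leaves countably many, whose union is still null.\<close>
  have "AE \<omega> in M. \<forall>i::nat. \<forall>\<^sub>F n in sequentially. cmod (\<xi> n \<omega>) \<le> exp (inverse (Suc i) * real n)"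
    using AE_root_test_le[OF assms(1)] by (simp add: AE_all_countable)
  moreover have "AE \<omega> in M. \<forall>i::nat. \<forall>\<^sub>F n in sequentially.
      \<exists>m\<le>n. (1 - inverse (Suc i)) * real n \<le> real m \<and> c \<le> cmod (\<xi> m \<omega>)"
    using large by (simp add: AE_all_countable)
  ultimately show ?thesis
  proof eventually_elim
    case (elim \<omega>)
    show ?case
      unfolding random_poly_def
    proof (rule annulus_zero_count_tendsto_1[OF _ _ c \<delta>])
      fix \<epsilon> :: real assume "\<epsilon> > 0"
      then obtain i where i: "inverse (real (Suc i)) \<le> \<epsilon>"
        using reals_Archimedean less_imp_le by blast
      show "\<forall>\<^sub>F n in sequentially. \<exists>m\<le>n. (1 - \<epsilon>) * real n \<le> real m \<and> c \<le> cmod (\<xi> m \<omega>)"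
        using elim(2)[rule_format, of i]
      proof eventually_elim
        case (elim n)
        moreover have "(1 - \<epsilon>) * real n \<le> (1 - inverse (real (Suc i))) * real n"
          using i by (intro mult_right_mono) auto
        ultimately show ?case by (meson order_trans)
      qed
    next
      fix \<epsilon> :: real assume "\<epsilon> > 0"
      then show "\<forall>\<^sub>F n in sequentially. \<forall>k\<le>n. cmod (\<xi> k \<omega>) \<le> exp (\<epsilon> * real n)"
      proof (rule eventually_all_le_exp[rotated])
        fix \<epsilon> :: real assume "\<epsilon> > 0"
        then obtain i where i: "inverse (real (Suc i)) \<le> \<epsilon>"
          using reals_Archimedean less_imp_le by blast
        show "\<forall>\<^sub>F n in sequentially. cmod (\<xi> n \<omega>) \<le> exp (\<epsilon> * real n)"
          using elim(1)[rule_format, of i]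
        proof eventually_elim
          case (elim n)
          also have "exp (inverse (real (Suc i)) * real n) \<le> exp (\<epsilon> * real n)"
            using mult_right_mono[OF i, of "real n"] by simp
          finally show ?case .
        qed
      qed
    qed
  qed
qed

section \<open>Infinite logarithmic moment\<close>

lemma AE_root_test_unbounded:
  assumes "\<not> (\<integral>\<^sup>+\<omega>. ennreal (ln (1 + cmod (\<xi> 0 \<omega>))) \<partial>M) < \<infinity>"
  shows "AE \<omega> in M. \<forall>C::nat. \<exists>n\<ge>1. real C ^ n < cmod (\<xi> n \<omega>)"
  unfolding AE_all_countable
proof
  fix C :: nat
  \<comment> \<open>The factor 2 absorbs the 1 in \<open>1 + cmod (\<xi> n \<omega>)\<close>: for
    \<open>n \<ge> 1\<close>, \<open>D ^ n\<close> is at least \<open>2 * (C + 1) ^ n\<close>, hence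
    at least \<open>C ^ n + 1\<close>.\<close>
  define D where "D = 2 * real (C + 1)"
  have D: "D \<ge> 2" by (simp add: D_def)
  have "\<not> summable (\<lambda>n. prob {\<omega> \<in> space M. ln D * real n < ln (1 + cmod (\<xi> 0 \<omega>))})"
    using assms D by (subst nn_integral_finite_iff_summable[symmetric]) auto
  also have "(\<lambda>n. prob {\<omega> \<in> space M. ln D * real n < ln (1 + cmod (\<xi> 0 \<omega>))}) =
    (\<lambda>n. prob {\<omega> \<in> space M. \<xi> n \<omega> \<in> {z. ln D * real n < ln (1 + cmod z)}})"
    unfolding mem_Collect_eq by (intro ext prob_coeff_eq[symmetric]) measurable
  finally have "AE \<omega> in M. \<exists>n\<ge>1. \<xi> n \<omega> \<in> {z. ln D * real n < ln (1 + cmod z)}"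
    by (intro AE_ex_if_not_summable[OF indep]) auto
  then show "AE \<omega> in M. \<exists>n\<ge>1. real C ^ n < cmod (\<xi> n \<omega>)"
  proof eventually_elim
    case (elim \<omega>)
    then obtain n where n: "n \<ge> 1" "ln D * real n < ln (1 + cmod (\<xi> n \<omega>))" by auto
    have "real C ^ n \<le> real (C + 1) ^ n" by (intro power_mono) auto
    moreover have "1 \<le> real (C + 1) ^ n" by (intro one_le_power) auto
    moreover have "2 * real (C + 1) ^ n \<le> 2 ^ n * real (C + 1) ^ n"
      using n(1) by (intro mult_right_mono self_le_power) auto
    moreover have "2 ^ n * real (C + 1) ^ n = D ^ n" by (simp only: D_def power_mult_distrib)
    moreover have "D ^ n < 1 + cmod (\<xi> n \<omega>)"
    proof -
      have "ln (D ^ n) < ln (1 + cmod (\<xi> n \<omega>))"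
        using n(2) D by (simp add: ln_realpow mult.commute)
      then show ?thesis using D by (subst (asm) ln_less_cancel_iff) (auto simp: add_pos_nonneg)
    qed
    ultimately have "real C ^ n < cmod (\<xi> n \<omega>)" by linarith
    with n(1) show ?case by blast
  qed
qed

text \<open>Convergence to 1 would make the count eventually positive, whereas almost surely it
  vanishes for arbitrarily large \<open>n\<close>.\<close>

lemma not_AE_annulus_zero_count_tendsto_1:
  assumes "\<not> (\<integral>\<^sup>+\<omega>. ennreal (ln (1 + cmod (\<xi> 0 \<omega>))) \<partial>M) < \<infinity>"
  shows "\<not> (AE \<omega> in M.
    (\<lambda>n. real (annulus_zero_count (random_poly \<xi> n \<omega>) (1/2) (ereal (3/2))) / real n) \<longlonglongrightarrow> 1)"
proof
  assume "AE \<omega> in M.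
    (\<lambda>n. real (annulus_zero_count (random_poly \<xi> n \<omega>) (1/2) (ereal (3/2))) / real n) \<longlonglongrightarrow> 1"
  then have "AE \<omega> in M. False"
    using AE_root_test_unbounded[OF assms]
  proof eventually_elim
    case (elim \<omega>)
    have "\<forall>\<^sub>F n in sequentially.
        0 < real (annulus_zero_count (random_poly \<xi> n \<omega>) (1/2) (ereal (3/2))) / real n"
      using order_tendstoD(1)[OF elim(1)] by simp
    then obtain N where N: "\<And>n. n \<ge> N \<Longrightarrow>
        annulus_zero_count (random_poly \<xi> n \<omega>) (1/2) (ereal (3/2)) \<noteq> 0"
      unfolding eventually_sequentially by fastforce
    have "\<exists>n\<ge>1. C ^ n < cmod (\<xi> n \<omega>)" if "C \<ge> 0" for C :: real
    proof -
      obtain n where n: "n \<ge> 1" "real (nat \<lceil>C\<rceil>) ^ n < cmod (\<xi> n \<omega>)" using elim(2) by blast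
      moreover have "C ^ n \<le> real (nat \<lceil>C\<rceil>) ^ n"
        using that by (intro power_mono real_nat_ceiling_ge)
      ultimately show ?thesis by (meson le_less_trans)
    qed
    then show False
      using annulus_zero_count_frequently_0[of "\<lambda>k. \<xi> k \<omega>" N] N
      unfolding random_poly_def by blast
  qed
  \<comment> \<open>A property that never holds cannot hold almost everywhere under a probability
    measure.\<close>
  then show False by simp
qed

end

end

theorem theorem1:
  fixes M :: "'w measure" and \<xi> :: "nat \<Rightarrow> 'w \<Rightarrow> complex"
  assumes "prob_space M"
    and "prob_space.indep_vars M (\<lambda>_. borel) \<xi> UNIV"
    and "\<And>k. distr M borel (\<xi> k) = distr M borel (\<xi> 0)"
    and "measure M {\<omega> \<in> space M. \<xi> 0 \<omega> = 0} < 1"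
  shows "(\<forall>\<delta>>0. AE \<omega> in M.
            (\<lambda>n. real (annulus_zero_count (random_poly \<xi> n \<omega>) (1 - \<delta>) (ereal (1 + \<delta>))) / real n)
              \<longlonglongrightarrow> 1)
         \<longleftrightarrow> (\<integral>\<^sup>+\<omega>. ennreal (ln (1 + cmod (\<xi> 0 \<omega>))) \<partial>M) < \<infinity>"
    (is "?conv \<longleftrightarrow> ?fin")
proof
  interpret prob_space M by fact
  show ?fin if ?conv
  proof (rule ccontr)
    assume "\<not> ?fin"
    from not_AE_annulus_zero_count_tendsto_1[OF assms(2,3) this] that[rule_format, of "1/2"]
    show False by simp
  qed
  show ?conv if ?fin
    using AE_annulus_zero_count_tendsto_1[OF assms(2,3) that assms(4)] by blast
qed

end
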